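(* Let $\rho>-1$ and $\kappa>-1$ be real numbers and let $m,n$ be nonnegative integers with $n+\rho\ge0$. Then, for $z\in\mathbb{D}^*$, $$\mathcal{Z}^{\kappa,\rho}_{m,n}(z,\bar z)=\frac{m!\,\Gamma(\rho+1)}{(\kappa+m+1)_n}\sum_{j=0}^{m\wedge^*\rho}\frac{(-1)^j}{j!\,(m-j)!\,\Gamma(\rho-j+1)}\,\frac{(1-|z|^2)^j}{z^j}\,\mathcal{Z}^{\kappa+j}_{m-j,n}(z,\bar z).$$
   Context: Let $\mathbb{D}=\{z\in\mathbb{C}:|z|<1\}$ and $\mathbb{D}^*=\mathbb{D}\setminus\{0\}$; $\partial/\partial z$, $\partial/\partial\bar z$ are the Wirtinger derivatives and $(a)_n=a(a+1)\cdots(a+n-1)$. For reals $\rho,\kappa>-1$ and integers $m\ge0$, $n$ with $n+\rho\ge0$, the fractional Zernike function on $\mathbb{D}^*$ is $$\mathcal{Z}^{\kappa,\rho}_{m,n}(z,\bar z)=(-1)^m z^{-\rho}(1-|z|^2)^{-\kappa}\frac{\partial^m}{\partial z^m}\Big(z^{n+\rho}(1-|z|^2)^{\kappa+m}\Big),$$ the powers $z^{-\rho}$ and $z^{n+\rho}$ being taken with the same local branch (the result does not depend on the choice). The classical complex Zernike (disc) polynomials (one upper index) are, for $\gamma>-1$ and integers $m,n\ge0$, $$\mathcal{Z}^{\gamma}_{m,n}(z,\bar z)=(-1)^{m+n}(1-|z|^2)^{-\gamma}\frac{\partial^{m+n}}{\partial z^m\partial\bar z^n}(1-|z|^2)^{\gamma+m+n}.$$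 For real $b$ and integer $m\ge0$: $m\wedge^*b=\min(m,b)$ if $b\in\{0,1,2,\dots\}$, and $m\wedge^* b=m$ otherwise. *)

theory Defs
  imports "HOL-Analysis.Analysis"
begin

definition wirtinger_z :: "(complex \<Rightarrow> complex) \<Rightarrow> complex \<Rightarrow> complex" where
  "wirtinger_z f z =
     (vector_derivative (\<lambda>t::real. f (z + of_real t)) (at 0)
      - \<i> * vector_derivative (\<lambda>t::real. f (z + \<i> * of_real t)) (at 0)) / 2"

definition wirtinger_zbar :: "(complex \<Rightarrow> complex) \<Rightarrow> complex \<Rightarrow> complex" where
  "wirtinger_zbar f z =
     (vector_derivative (\<lambda>t::real. f (z + of_real t)) (at 0)
      + \<i> * vector_derivative (\<lambda>t::real. f (z + \<i> * of_real t)) (at 0)) / 2"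

definition log_branch :: "complex set \<Rightarrow> (complex \<Rightarrow> complex) \<Rightarrow> bool" where
  "log_branch U L \<longleftrightarrow> open U \<and> L holomorphic_on U \<and> (\<forall>w\<in>U. exp (L w) = w)"

lemma log_branch_exists:
  assumes "z \<noteq> 0"
  shows "\<exists>U L. log_branch U L \<and> z \<in> U"
proof (intro exI conjI)
  let ?U = "{w. Re (w / z) > 0}"
  let ?L = "\<lambda>w. Ln z + Ln (w / z)"
  have "open ?U"
    using assms by (intro open_Collect_less continuous_intros) auto
  moreover have "?L holomorphic_on ?U"
    using assms by (intro holomorphic_intros) (auto simp: complex_nonpos_Reals_iff)
  moreover have "exp (?L w) = w" if "w \<in> ?U" for w
  proof -
    have "w \<noteq> 0" using that by auto
    then show ?thesis using assms by (simp add: exp_add)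
  qed
  ultimately show "log_branch ?U ?L" by (simp add: log_branch_def)
  show "z \<in> ?U" using assms by simp
qed

text \<open>The fractional Zernike function, computed with the local branch
  \<open>w\<^sup>a = exp (a * L w)\<close> for both powers, where \<open>L\<close> is a branch of the logarithm
  near the point of evaluation (see \<open>log_branch\<close>).  The value does not depend on the branch:
  for integer \<open>n\<close>, adding \<open>2 * pi * \<i> * k\<close> to \<open>L\<close> multiplies the two powers
  by factors with product 1.  The branch is kept as a parameter so that results can be stated
  for every choice of it.  Intended range: \<open>0 < |z| < 1\<close>, \<open>\<rho>, \<kappa> > -1\<close>
  and \<open>n + \<rho> \<ge> 0\<close>.\<close>

definition frac_zernike ::
  "(complex \<Rightarrow> complex) \<Rightarrow> real \<Rightarrow> real \<Rightarrow> nat \<Rightarrow> int \<Rightarrow> complex \<Rightarrow> complex" where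
  "frac_zernike L \<kappa> \<rho> m n z =
     (-1) ^ m * exp (of_real (-\<rho>) * L z) * of_real ((1 - (cmod z)\<^sup>2) powr (-\<kappa>))
     * (wirtinger_z ^^ m)
         (\<lambda>w. exp (of_real (of_int n + \<rho>) * L w)
               * of_real ((1 - (cmod w)\<^sup>2) powr (\<kappa> + real m))) z"

definition zernike :: "real \<Rightarrow> nat \<Rightarrow> nat \<Rightarrow> complex \<Rightarrow> complex" where
  "zernike \<gamma> m n z =
     (-1) ^ (m + n) * of_real ((1 - (cmod z)\<^sup>2) powr (-\<gamma>))
     * (wirtinger_z ^^ m) ((wirtinger_zbar ^^ n)
         (\<lambda>w. of_real ((1 - (cmod w)\<^sup>2) powr (\<gamma> + real m + real n)))) z"

definition wedge_star :: "nat \<Rightarrow> real \<Rightarrow> nat" where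
  "wedge_star m b = (if b \<in> \<nat> then min m (nat \<lfloor>b\<rfloor>) else m)"

end

theory Submission
  imports Defs
begin

text \<open>
  Write \<open>u = 1 - |w|\<^sup>2\<close>.  The formula is the Leibniz rule for \<open>\<partial>\<^sup>m/\<partial>z\<^sup>m\<close> applied to the
  factorisation \<open>w\<^sup>n\<^sup>+\<^sup>\<rho> u\<^sup>\<kappa>\<^sup>+\<^sup>m = w\<^sup>\<rho> \<cdot> (w\<^sup>n u\<^sup>\<kappa>\<^sup>+\<^sup>m)\<close>.  The derivatives of the two factors
  are known.

  On the one hand \<open>\<partial>\<^sup>j w\<^sup>\<rho> = \<Gamma>(\<rho> + 1) / \<Gamma>(\<rho> - j + 1) \<cdot> w\<^sup>\<rho> / w\<^sup>j\<close>, where the Gamma quotient is a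
  falling factorial and vanishes when \<open>\<rho>\<close> is a natural number below \<open>j\<close>; this is why the sum
  stops at \<open>m \<and>\<^sup>* \<rho>\<close>
  (\<open>wirtinger_z_tower_power_branch\<close>, \<open>Gamma_quotient_eq_pochhammer\<close>).

  On the other hand, differentiating \<open>u\<^sup>\<gamma>\<^sup>+\<^sup>m\<^sup>+\<^sup>n\<close> with respect to the conjugate variable \<open>n\<close> times
  produces \<open>w\<^sup>n u\<^sup>\<gamma>\<^sup>+\<^sup>m\<close> times \<open>(-1)\<^sup>n (\<gamma> + m + 1)\<^sub>n\<close>, so that the disc polynomial is also
  \<open>(-1)\<^sup>m (\<gamma> + m + 1)\<^sub>n u\<^sup>-\<^sup>\<gamma> \<partial>\<^sup>m (w\<^sup>n u\<^sup>\<gamma>\<^sup>+\<^sup>m)\<close> (\<open>zernike_eq_tower\<close>).  Taking \<open>\<gamma> = \<kappa> + j\<close> and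
  \<open>m - j\<close> for \<open>m\<close> leaves \<open>\<gamma> + m = \<kappa> + m\<close> unchanged.  Hence the factor
  \<open>\<partial>\<^sup>m\<^sup>-\<^sup>j (w\<^sup>n u\<^sup>\<kappa>\<^sup>+\<^sup>m)\<close> in the \<open>j\<close>-th Leibniz term is a multiple of the disc polynomial with upper
  index \<open>\<kappa> + j\<close> and lower indices \<open>m - j, n\<close>, and the Pochhammer symbol is the same for all \<open>j\<close>.

  The Wirtinger operators are built from derivatives along two lines, and these alone give neither
  a product rule nor iterates that are known to be differentiable again.  The proof therefore
  works with sequences of functions each of which is real differentiable with the next one as its
  \<open>\<partial>/\<partial>z\<close> derivative (\<open>wirtinger_z_tower\<close>).  Such towers are closed under the Leibniz
  convolution (\<open>wirtinger_z_tower_Leibniz\<close>), and a tower on an open set computes the iterates of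
  the operator on its bottom function (\<open>higher_wirtinger_z_tower\<close>).
\<close>

section \<open>Wirtinger derivatives\<close>

text \<open>Real differentiability, with the real-linear differential written in its unique form
  \<open>h \<mapsto> a h + b h\<^sup>*\<close>; the coefficients are then the two Wirtinger derivatives.\<close>

definition has_wirtinger ::
  "(complex \<Rightarrow> complex) \<Rightarrow> complex \<Rightarrow> complex \<Rightarrow> complex \<Rightarrow> bool" where
  "has_wirtinger f a b z \<longleftrightarrow> (f has_derivative (\<lambda>h. a * h + b * cnj h)) (at z)"

lemma has_wirtinger_imp_vector_derivative:
  assumes "has_wirtinger f a b z"
  shows "vector_derivative (\<lambda>t::real. f (z + c * of_real t)) (at 0) = a * c + b * cnj c"
proof -
  have f: "(f has_derivative (\<lambda>h. a * h + b * cnj h)) (at (z + c * of_real 0))"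
    using assms by (simp add: has_wirtinger_def)
  have line: "((\<lambda>t::real. z + c * of_real t) has_derivative (\<lambda>t. c * of_real t)) (at 0)"
    by (auto intro!: derivative_eq_intros)
  have "((\<lambda>t::real. f (z + c * of_real t)) has_derivative
      (\<lambda>t. a * (c * of_real t) + b * cnj (c * of_real t))) (at 0)"
    using has_derivative_compose[OF line f] .
  also have "(\<lambda>t::real. a * (c * of_real t) + b * cnj (c * of_real t))
      = (\<lambda>t. t *\<^sub>R (a * c + b * cnj c))"
    by (simp add: scaleR_conv_of_real algebra_simps)
  finally show ?thesis
    by (intro vector_derivative_at) (simp add: has_vector_derivative_def)
qed

lemma has_wirtinger_imp_wirtinger_z:
  assumes "has_wirtinger f a b z"
  shows "wirtinger_z f z = a"
  using has_wirtinger_imp_vector_derivative[OF assms, of 1]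
    has_wirtinger_imp_vector_derivative[OF assms, of \<i>]
  by (simp add: wirtinger_z_def right_diff_distrib left_diff_distrib mult.left_commute[of \<i>])

lemma has_wirtinger_imp_wirtinger_zbar:
  assumes "has_wirtinger f a b z"
  shows "wirtinger_zbar f z = b"
  using has_wirtinger_imp_vector_derivative[OF assms, of 1]
    has_wirtinger_imp_vector_derivative[OF assms, of \<i>]
  by (simp add: wirtinger_zbar_def right_diff_distrib left_diff_distrib mult.left_commute[of \<i>])

lemma has_wirtinger_const: "has_wirtinger (\<lambda>w. c) 0 0 z"
  by (simp add: has_wirtinger_def)

lemma has_wirtinger_add:
  assumes "has_wirtinger f a b z" "has_wirtinger g c d z"
  shows "has_wirtinger (\<lambda>w. f w + g w) (a + c) (b + d) z"
proof -
  have "((\<lambda>w. f w + g w) has_derivative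
      (\<lambda>h. (a * h + b * cnj h) + (c * h + d * cnj h))) (at z)"
    using assms unfolding has_wirtinger_def by (rule has_derivative_add)
  then show ?thesis by (simp add: has_wirtinger_def algebra_simps)
qed

lemma has_wirtinger_mult:
  assumes "has_wirtinger f a b z" "has_wirtinger g c d z"
  shows "has_wirtinger (\<lambda>w. f w * g w) (a * g z + f z * c) (b * g z + f z * d) z"
proof -
  have "((\<lambda>w. f w * g w) has_derivative
      (\<lambda>h. f z * (c * h + d * cnj h) + (a * h + b * cnj h) * g z)) (at z)"
    using assms unfolding has_wirtinger_def by (rule has_derivative_mult)
  then show ?thesis by (simp add: has_wirtinger_def algebra_simps)
qed

lemma has_wirtinger_sum:
  assumes "finite I" "\<And>i. i \<in> I \<Longrightarrow> has_wirtinger (f i) (a i) (b i) z"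
  shows "has_wirtinger (\<lambda>w. \<Sum>i\<in>I. f i w) (\<Sum>i\<in>I. a i) (\<Sum>i\<in>I. b i) z"
  using assms
  by (induction I rule: finite_induct) (auto simp: has_wirtinger_add, simp add: has_wirtinger_def)

lemma has_wirtinger_holomorphic:
  assumes "(f has_field_derivative a) (at z)"
  shows "has_wirtinger f a 0 z"
  using assms by (simp add: has_wirtinger_def has_field_derivative_def)

lemma has_wirtinger_cnj_power:
  "has_wirtinger (\<lambda>w. cnj w ^ k) 0 (of_nat k * cnj z ^ (k - 1)) z"
proof -
  have "(cnj has_derivative cnj) (at z)"
    by (rule bounded_linear_imp_has_derivative[OF bounded_linear_cnj])
  then have "((\<lambda>w. cnj w ^ k) has_derivative (\<lambda>h. of_nat k * cnj h * cnj z ^ (k - 1))) (at z)"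
    by (rule has_derivative_power)
  also have "(\<lambda>h. of_nat k * cnj h * cnj z ^ (k - 1))
      = (\<lambda>h. 0 * h + of_nat k * cnj z ^ (k - 1) * cnj h)"
    by (simp add: fun_eq_iff)
  finally show ?thesis unfolding has_wirtinger_def .
qed

text \<open>The weight \<open>1 - |w|\<^sup>2\<close> is \<open>1 - w w\<^sup>*\<close>, so the Wirtinger derivatives of its powers come from
  the chain rule with inner derivatives \<open>-w\<^sup>*\<close> and \<open>-w\<close>.  Inside the disc the base of the real power is
  positive, which makes every real exponent admissible.\<close>

lemma has_wirtinger_disc_weight_powr:
  assumes "z \<in> ball 0 1"
  shows "has_wirtinger (\<lambda>w. of_real ((1 - (cmod w)\<^sup>2) powr a))
    (- of_real (a * (1 - (cmod z)\<^sup>2) powr (a - 1)) * cnj z)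
    (- of_real (a * (1 - (cmod z)\<^sup>2) powr (a - 1)) * z) z"
proof -
  define u where "u = 1 - (cmod z)\<^sup>2"
  have u: "u > 0"
    using assms by (simp add: u_def power_less_one_iff abs_square_less_1)
  have weight: "((\<lambda>w. 1 - (cmod w)\<^sup>2) has_derivative (\<lambda>h. - (2 * (z \<bullet> h)))) (at z)"
    unfolding power2_norm_eq_inner
    by (auto intro!: derivative_eq_intros simp: inner_commute)
  have "((\<lambda>x. x powr a) has_derivative (\<lambda>x. a * u powr (a - 1) * x)) (at u)"
    using has_real_derivative_powr[OF u, of a] by (simp add: has_field_derivative_def)
  then have "((\<lambda>w. (1 - (cmod w)\<^sup>2) powr a) has_derivative
      (\<lambda>h. a * u powr (a - 1) * (- (2 * (z \<bullet> h))))) (at z)"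
    unfolding u_def by (rule has_derivative_compose[OF weight])
  then have "((\<lambda>w. complex_of_real ((1 - (cmod w)\<^sup>2) powr a)) has_derivative
      (\<lambda>h. of_real (a * u powr (a - 1) * (- (2 * (z \<bullet> h)))))) (at z)"
    by (rule has_derivative_of_real)
  also have "(\<lambda>h. complex_of_real (a * u powr (a - 1) * (- (2 * (z \<bullet> h)))))
      = (\<lambda>h. - of_real (a * u powr (a - 1)) * cnj z * h
            + - of_real (a * u powr (a - 1)) * z * cnj h)"
  proof
    fix h
    have "complex_of_real (2 * (z \<bullet> h)) = cnj z * h + z * cnj h"
      by (simp add: complex_eq_iff inner_complex_def)
    then show "complex_of_real (a * u powr (a - 1) * (- (2 * (z \<bullet> h))))
      = - of_real (a * u powr (a - 1)) * cnj z * h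
            + - of_real (a * u powr (a - 1)) * z * cnj h"
      by (simp only: of_real_mult of_real_minus) (simp add: algebra_simps)
  qed
  finally show ?thesis by (simp add: has_wirtinger_def u_def)
qed

section \<open>Iterated Wirtinger derivatives\<close>

text \<open>Locality of the operators, for arbitrary functions: it lets a closed form that holds only on
  an open set be substituted below a further derivative.\<close>

lemma wirtinger_cong_open:
  assumes "open V" "z \<in> V" "\<And>w. w \<in> V \<Longrightarrow> f w = g w"
  shows "wirtinger_z f z = wirtinger_z g z" "wirtinger_zbar f z = wirtinger_zbar g z"
proof -
  have "vector_derivative (\<lambda>t::real. f (z + c * of_real t)) (at 0)
      = vector_derivative (\<lambda>t::real. g (z + c * of_real t)) (at 0)" for c
  proof (rule vector_derivative_cong_eq)
    have "((\<lambda>t::real. z + c * of_real t) \<longlongrightarrow> z + c * of_real 0) (nhds 0)"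
      by (intro tendsto_intros filterlim_ident)
    then have "eventually (\<lambda>t::real. z + c * of_real t \<in> V) (nhds 0)"
      using assms(1,2) by (auto dest: topological_tendstoD)
    then show "eventually (\<lambda>t::real. t \<in> UNIV \<longrightarrow> f (z + c * of_real t) = g (z + c * of_real t)) (nhds 0)"
      by eventually_elim (simp add: assms(3))
  qed auto
  from this[of 1] this[of \<i>]
  show "wirtinger_z f z = wirtinger_z g z" "wirtinger_zbar f z = wirtinger_zbar g z"
    by (simp_all add: wirtinger_z_def wirtinger_zbar_def)
qed

text \<open>Each member is real differentiable, which the product rule requires, and the next member is its
  \<open>\<partial>/\<partial>z\<close> derivative.  Hiding the conjugate derivative behind an existential spares the Leibniz
  convolution a second formula.\<close>

definition wirtinger_z_tower :: "complex set \<Rightarrow> (nat \<Rightarrow> complex \<Rightarrow> complex) \<Rightarrow> bool" where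
  "wirtinger_z_tower V F \<longleftrightarrow> (\<forall>k. \<forall>w\<in>V. \<exists>b. has_wirtinger (F k) (F (Suc k) w) b w)"

lemma higher_wirtinger_z_tower:
  assumes "wirtinger_z_tower V F" "open V" "\<And>w. w \<in> V \<Longrightarrow> f w = F 0 w" "z \<in> V"
  shows "(wirtinger_z ^^ k) f z = F k z"
  using assms(4)
proof (induction k arbitrary: z)
  case 0
  then show ?case by (simp add: assms(3))
next
  case (Suc k)
  have "wirtinger_z ((wirtinger_z ^^ k) f) z = wirtinger_z (F k) z"
    using assms(2) Suc.prems Suc.IH by (rule wirtinger_cong_open(1))
  also have "\<dots> = F (Suc k) z"
    using assms(1) Suc.prems has_wirtinger_imp_wirtinger_z
    unfolding wirtinger_z_tower_def by blast
  finally show ?case by simp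
qed

lemma wirtinger_z_tower_cmult:
  assumes "wirtinger_z_tower V F"
  shows "wirtinger_z_tower V (\<lambda>k w. c * F k w)"
  unfolding wirtinger_z_tower_def
proof (intro allI ballI)
  fix k w assume "w \<in> V"
  then obtain b where "has_wirtinger (F k) (F (Suc k) w) b w"
    using assms unfolding wirtinger_z_tower_def by blast
  then show "\<exists>b. has_wirtinger (\<lambda>w. c * F k w) (c * F (Suc k) w) b w"
    using has_wirtinger_mult[OF has_wirtinger_const[of c]] by fastforce
qed

text \<open>The usual induction step for the Leibniz rule: the product rule shifts one of the two indices,
  and Pascal's rule recombines the two sums.  Stated for towers, it also gives the differentiability
  of the product's derivatives, so the lemma can be applied to its own output.\<close>

lemma wirtinger_z_tower_Leibniz:
  assumes "wirtinger_z_tower V F" "wirtinger_z_tower V G"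
  shows "wirtinger_z_tower V (\<lambda>k w. \<Sum>j\<le>k. of_nat (k choose j) * F j w * G (k - j) w)"
  unfolding wirtinger_z_tower_def
proof (intro allI ballI)
  fix k w assume w: "w \<in> V"
  have "\<forall>i. \<exists>b. has_wirtinger (F i) (F (Suc i) w) b w"
    using assms(1) w unfolding wirtinger_z_tower_def by blast
  from choice[OF this]
  obtain p where p: "\<And>i. has_wirtinger (F i) (F (Suc i) w) (p i) w" by blast
  have "\<forall>i. \<exists>b. has_wirtinger (G i) (G (Suc i) w) b w"
    using assms(2) w unfolding wirtinger_z_tower_def by blast
  from choice[OF this]
  obtain q where q: "\<And>i. has_wirtinger (G i) (G (Suc i) w) (q i) w" by blast
  define t where "t i = F i w * G (Suc k - i) w" for i
  have "has_wirtinger (\<lambda>w. of_nat (k choose j) * (F j w * G (k - j) w))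
      (of_nat (k choose j) * (F (Suc j) w * G (k - j) w + F j w * G (Suc (k - j)) w))
      (of_nat (k choose j) * (p j * G (k - j) w + F j w * q (k - j))) w" for j
    using has_wirtinger_mult[OF has_wirtinger_const[of "of_nat (k choose j)"]
        has_wirtinger_mult[OF p[of j] q[of "k - j"]]]
    by simp
  then have "has_wirtinger (\<lambda>w. \<Sum>j\<le>k. of_nat (k choose j) * (F j w * G (k - j) w))
      (\<Sum>j\<le>k. of_nat (k choose j) * (F (Suc j) w * G (k - j) w + F j w * G (Suc (k - j)) w))
      (\<Sum>j\<le>k. of_nat (k choose j) * (p j * G (k - j) w + F j w * q (k - j))) w"
    by (intro has_wirtinger_sum) auto
  moreover have "(\<Sum>j\<le>k. of_nat (k choose j) * (F (Suc j) w * G (k - j) w + F j w * G (Suc (k - j)) w))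
      = (\<Sum>j\<le>Suc k. of_nat (Suc k choose j) * F j w * G (Suc k - j) w)"
  proof -
    have "(\<Sum>j\<le>k. of_nat (k choose j) * (F (Suc j) w * G (k - j) w + F j w * G (Suc (k - j)) w))
      = (\<Sum>j\<le>k. of_nat (k choose j) * t (Suc j)) + (\<Sum>j\<le>k. of_nat (k choose j) * t j)"
      by (simp add: t_def sum.distrib[symmetric] Suc_diff_le distrib_left)
    also have "(\<Sum>j\<le>k. of_nat (k choose j) * t j) = (\<Sum>j\<le>Suc k. of_nat (k choose j) * t j)"
      by simp
    also have "\<dots> = t 0 + (\<Sum>j\<le>k. of_nat (k choose Suc j) * t (Suc j))"
      by (subst sum.atMost_Suc_shift) simp
    also have "(\<Sum>j\<le>k. of_nat (k choose j) * t (Suc j)) + \<dots>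
      = t 0 + (\<Sum>j\<le>k. of_nat (Suc k choose Suc j) * t (Suc j))"
      by (simp add: sum.distrib algebra_simps)
    also have "\<dots> = (\<Sum>j\<le>Suc k. of_nat (Suc k choose j) * t j)"
      by (subst sum.atMost_Suc_shift) simp
    finally show ?thesis by (simp add: t_def mult.assoc)
  qed
  ultimately show "\<exists>b. has_wirtinger (\<lambda>w. \<Sum>j\<le>k. of_nat (k choose j) * F j w * G (k - j) w)
      (\<Sum>j\<le>Suc k. of_nat (Suc k choose j) * F j w * G (Suc k - j) w) b w"
    by (auto simp: mult.assoc)
qed

section \<open>Powers of the variable and of the disc weight\<close>

text \<open>The derivatives of \<open>w\<^sup>a = exp (a L w)\<close>.  The coefficient \<open>(-1)\<^sup>k (-a)\<^sub>k\<close> is the falling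
  factorial \<open>a (a - 1) \<cdots> (a - k + 1)\<close>; the Pochhammer form has the required recursion for every
  real \<open>a\<close>, without the poles of a Gamma quotient.\<close>

lemma wirtinger_z_tower_power_branch:
  assumes "log_branch U L"
  shows "wirtinger_z_tower U
    (\<lambda>k w. of_real ((-1) ^ k * pochhammer (- a) k) * exp (of_real (a - real k) * L w))"
  unfolding wirtinger_z_tower_def
proof (intro allI ballI)
  fix k w assume w: "w \<in> U"
  have U: "open U" "L holomorphic_on U" and exp_L: "\<And>v. v \<in> U \<Longrightarrow> exp (L v) = v"
    using assms by (auto simp: log_branch_def)
  have L': "(L has_field_derivative deriv L w) (at w)"
    using U(2,1) w by (rule holomorphic_derivI)
  \<comment> \<open>Differentiating \<open>exp (L w) = w\<close> gives \<open>L' w = 1 / w\<close>, written as \<open>exp (- L w)\<close> so that it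
     lowers the exponent of the branch power by one.\<close>
  have "((\<lambda>v. exp (L v)) has_field_derivative exp (L w) * deriv L w) (at w)"
    using L' by (auto intro!: derivative_eq_intros)
  then have "((\<lambda>v. v) has_field_derivative exp (L w) * deriv L w) (at w)"
    using has_field_derivative_transform_within_open[OF _ U(1) w] exp_L by metis
  then have "exp (L w) * deriv L w = 1"
    using DERIV_ident DERIV_unique by blast
  then have deriv_L: "deriv L w = exp (- L w)"
    by (simp add: exp_minus field_simps)
  have lower: "exp (of_real (a - real k) * L w) * exp (- L w) = exp (of_real (a - real (Suc k)) * L w)"
    by (simp add: exp_add[symmetric] algebra_simps)
  have "((\<lambda>v. of_real ((-1) ^ k * pochhammer (- a) k) * exp (of_real (a - real k) * L v))
      has_field_derivative of_real ((-1) ^ k * pochhammer (- a) k)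
        * (exp (of_real (a - real k) * L w) * (of_real (a - real k) * deriv L w))) (at w)"
    by (rule derivative_eq_intros L' refl | simp)+
  also have "of_real ((-1) ^ k * pochhammer (- a) k)
        * (exp (of_real (a - real k) * L w) * (of_real (a - real k) * deriv L w))
      = of_real ((-1) ^ Suc k * pochhammer (- a) (Suc k))
        * exp (of_real (a - real (Suc k)) * L w)"
    unfolding lower[symmetric] deriv_L by (simp add: pochhammer_Suc algebra_simps)
  finally show "\<exists>b. has_wirtinger
      (\<lambda>w. of_real ((-1) ^ k * pochhammer (- a) k) * exp (of_real (a - real k) * L w))
      (of_real ((-1) ^ Suc k * pochhammer (- a) (Suc k)) * exp (of_real (a - real (Suc k)) * L w)) b w"
    using has_wirtinger_holomorphic by blast
qed

text \<open>For \<open>\<partial>/\<partial>z\<close> the factor \<open>w\<^sup>*\<close> produced by the weight is a constant, so each step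
  multiplies by another \<open>w\<^sup>*\<close> and lowers the exponent.\<close>

lemma wirtinger_z_tower_disc_weight:
  "wirtinger_z_tower (ball 0 1)
    (\<lambda>k w. of_real (pochhammer (- a) k) * cnj w ^ k
      * of_real ((1 - (cmod w)\<^sup>2) powr (a - real k)))"
  unfolding wirtinger_z_tower_def
proof (intro allI ballI)
  fix k and w :: complex assume w: "w \<in> ball 0 1"
  let ?v = "complex_of_real (pochhammer (- a) k) * cnj w ^ k
      * (- of_real ((a - real k) * (1 - (cmod w)\<^sup>2) powr (a - real k - 1)) * cnj w)"
  have "\<exists>b. has_wirtinger
      (\<lambda>w. of_real (pochhammer (- a) k) * cnj w ^ k
        * of_real ((1 - (cmod w)\<^sup>2) powr (a - real k))) ?v b w"
    using has_wirtinger_mult[OF has_wirtinger_mult[OF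
          has_wirtinger_const[of "of_real (pochhammer (- a) k)"] has_wirtinger_cnj_power]
        has_wirtinger_disc_weight_powr[OF w, of "a - real k"]]
    by (intro exI) simp
  also have "?v = of_real (pochhammer (- a) (Suc k)) * cnj w ^ Suc k
        * of_real ((1 - (cmod w)\<^sup>2) powr (a - real (Suc k)))"
    by (simp add: pochhammer_Suc algebra_simps)
  finally show "\<exists>b. has_wirtinger
      (\<lambda>w. of_real (pochhammer (- a) k) * cnj w ^ k
        * of_real ((1 - (cmod w)\<^sup>2) powr (a - real k)))
      (of_real (pochhammer (- a) (Suc k)) * cnj w ^ Suc k
        * of_real ((1 - (cmod w)\<^sup>2) powr (a - real (Suc k)))) b w" .
qed

text \<open>The mirror image for the conjugate operator, where it is \<open>w\<close> that behaves as a constant.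
  This is where the factor \<open>w\<^sup>n\<close> in the Zernike functions comes from.\<close>

lemma higher_wirtinger_zbar_disc_weight:
  assumes "w \<in> ball 0 1"
  shows "(wirtinger_zbar ^^ n) (\<lambda>w. of_real ((1 - (cmod w)\<^sup>2) powr a)) w
    = of_real (pochhammer (- a) n) * w ^ n * of_real ((1 - (cmod w)\<^sup>2) powr (a - real n))"
  using assms
proof (induction n arbitrary: w)
  case 0
  then show ?case by simp
next
  case (Suc n)
  have "((\<lambda>w. w ^ n) has_field_derivative of_nat n * w ^ (n - 1)) (at w)"
    by (auto intro!: derivative_eq_intros)
  note has_wirtinger_imp_wirtinger_zbar[OF has_wirtinger_mult[OF
      has_wirtinger_mult[OF has_wirtinger_const[of "of_real (pochhammer (- a) n)"]
        has_wirtinger_holomorphic[OF this]]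
      has_wirtinger_disc_weight_powr[OF Suc.prems]]]
  then have "wirtinger_zbar (\<lambda>w. of_real (pochhammer (- a) n) * w ^ n
        * of_real ((1 - (cmod w)\<^sup>2) powr (a - real n))) w
      = of_real (pochhammer (- a) (Suc n)) * w ^ Suc n
        * of_real ((1 - (cmod w)\<^sup>2) powr (a - real (Suc n)))"
    by (simp add: pochhammer_Suc algebra_simps)
  then show ?case
    using wirtinger_cong_open(2)[OF open_ball Suc.prems Suc.IH] by simp
qed

section \<open>Zernike functions\<close>

text \<open>Once the \<open>n\<close> conjugate derivatives are carried out, a disc polynomial involves only
  \<open>\<partial>\<^sup>m (w\<^sup>n u\<^sup>\<gamma>\<^sup>+\<^sup>m)\<close>, which is read off from any tower over that function.  Only the sum
  \<open>\<gamma> + m\<close> enters the bottom of the tower, so for fixed \<open>n\<close> one tower serves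
  all pairs with the same sum.\<close>

lemma zernike_eq_tower:
  assumes G: "wirtinger_z_tower V G" and V: "open V" "V \<subseteq> ball 0 1" "z \<in> V"
    and G0: "\<And>w. w \<in> V \<Longrightarrow> G 0 w = w ^ n * of_real ((1 - (cmod w)\<^sup>2) powr (\<gamma> + real m))"
  shows "zernike \<gamma> m n z = (-1) ^ m * of_real ((1 - (cmod z)\<^sup>2) powr (- \<gamma>))
    * of_real (pochhammer (\<gamma> + real m + 1) n) * G m z"
proof -
  define c where "c = complex_of_real ((-1) ^ n * pochhammer (\<gamma> + real m + 1) n)"
  have "(wirtinger_zbar ^^ n)
      (\<lambda>w. of_real ((1 - (cmod w)\<^sup>2) powr (\<gamma> + real m + real n))) w = c * G 0 w" if "w \<in> V" for w
    using that V(2) G0[OF that] pochhammer_minus[of "\<gamma> + real m + real n" n]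
    by (subst higher_wirtinger_zbar_disc_weight) (auto simp: c_def)
  then have "(wirtinger_z ^^ m) ((wirtinger_zbar ^^ n)
      (\<lambda>w. of_real ((1 - (cmod w)\<^sup>2) powr (\<gamma> + real m + real n)))) z = c * G m z"
    using higher_wirtinger_z_tower[OF wirtinger_z_tower_cmult[OF G] V(1)] V(3) by blast
  then show ?thesis
    by (simp add: zernike_def c_def power_add)
qed

text \<open>At a pole the value of \<open>Gamma\<close> and the reciprocal of \<open>0\<close> are both \<open>0\<close>, which agrees with the
  analytic meaning \<open>1 / \<Gamma> = 0\<close>.  A pole forces \<open>\<rho>\<close> to be a natural number below \<open>j\<close>, and then
  \<open>(-\<rho>)\<^sub>j\<close> contains the factor \<open>0\<close> too.\<close>

lemma Gamma_quotient_eq_pochhammer: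
  fixes \<rho> :: real
  assumes "\<rho> > -1"
  shows "Gamma (\<rho> + 1) / Gamma (\<rho> - real j + 1) = (-1) ^ j * pochhammer (- \<rho>) j"
proof (cases "\<rho> - real j + 1 \<in> \<int>\<^sub>\<le>\<^sub>0")
  case True
  then obtain k where k: "\<rho> - real j + 1 = - real k"
    by (auto elim!: nonpos_Ints_cases')
  then have r: "\<rho> = real j - real k - 1" by simp
  with assms have "k < j" by simp
  then have "- \<rho> = - of_nat (j - k - 1)" using r by (simp add: of_nat_diff)
  then have "pochhammer (- \<rho>) j = 0"
    using \<open>k < j\<close> by (auto simp: pochhammer_eq_0_iff intro!: exI[of _ "j - k - 1"])
  then show ?thesis using True by (simp add: Gamma_eq_zero_iff)
next
  case False
  then show ?thesis
    using pochhammer_Gamma[OF False, of j] by (simp add: pochhammer_minus flip: power_mult_distrib)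
qed

text \<open>This shows that the summation may be extended from \<open>m \<and>\<^sup>* \<rho>\<close> to \<open>m\<close>, the natural range of the
  Leibniz rule: the additional terms are divided by a pole of \<open>\<Gamma>\<close>.\<close>

lemma Gamma_zero_beyond_wedge_star:
  assumes "\<rho> > -1" "wedge_star m \<rho> < j" "j \<le> m"
  shows "Gamma (\<rho> - real j + 1) = 0"
proof -
  from assms obtain r where r: "\<rho> = real r"
    by (auto simp: wedge_star_def elim!: Nats_cases split: if_splits)
  with assms have "r < j" by (auto simp: wedge_star_def)
  then have "\<rho> - real j + 1 = - real (j - r - 1)" using r by (simp add: of_nat_diff)
  then show ?thesis by (simp only: Gamma_eq_zero_iff) simp
qed

theorem proposition3p1:
  fixes \<rho> \<kappa> :: real and m n :: nat and z :: complex
    and U :: "complex set" and L :: "complex \<Rightarrow> complex"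
  assumes "\<rho> > -1" and "\<kappa> > -1" and "real n + \<rho> \<ge> 0"
    and "z \<in> ball 0 1 - {0}"
    and "log_branch U L" and "z \<in> U"
  shows "frac_zernike L \<kappa> \<rho> m (int n) z =
    of_real (fact m * Gamma (\<rho> + 1) / pochhammer (\<kappa> + real m + 1) n)
    * (\<Sum>j = 0..wedge_star m \<rho>.
        of_real ((-1) ^ j / (fact j * fact (m - j) * Gamma (\<rho> - real j + 1)))
        * (of_real ((1 - (cmod z)\<^sup>2) ^ j) / z ^ j)
        * zernike (\<kappa> + real j) (m - j) n z)"
proof -
  \<comment> \<open>\<open>F\<close> is the tower over \<open>w\<^sup>\<rho>\<close>, and \<open>G\<close> the one over \<open>w\<^sup>n u\<^sup>\<kappa>\<^sup>+\<^sup>m\<close>.  The latter is itself a Leibniz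
     product, in which \<open>w\<^sup>n\<close> is treated as the branch power \<open>exp (n L w)\<close>.\<close>
  define V where "V = U \<inter> ball 0 1"
  define u where "u = 1 - (cmod z)\<^sup>2"
  define P where "P = pochhammer (\<kappa> + real m + 1) n"
  define F where "F = (\<lambda>k w. complex_of_real ((-1) ^ k * pochhammer (- \<rho>) k)
    * exp (of_real (\<rho> - real k) * L w))"
  define X where "X = (\<lambda>k w. complex_of_real ((-1) ^ k * pochhammer (- real n) k)
    * exp (of_real (real n - real k) * L w))"
  define Y where "Y = (\<lambda>k w. complex_of_real (pochhammer (- (\<kappa> + real m)) k) * cnj w ^ k
    * of_real ((1 - (cmod w)\<^sup>2) powr (\<kappa> + real m - real k)))"
  define G where "G = (\<lambda>k w. \<Sum>j\<le>k. of_nat (k choose j) * X j w * Y (k - j) w)"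
  have V: "open V" "V \<subseteq> ball 0 1" "z \<in> V"
    using assms by (auto simp: V_def log_branch_def)
  have exp_L: "exp (L w) = w" if "w \<in> V" for w
    using that assms(5) by (auto simp: V_def log_branch_def)
  have u: "u > 0"
    using V by (auto simp: u_def power_less_one_iff abs_square_less_1)
  have P: "P \<noteq> 0"
    using assms(2) pochhammer_pos[of "\<kappa> + real m + 1" n] by (simp add: P_def)
  have tower_mono: "wirtinger_z_tower V T" if "wirtinger_z_tower S T" "V \<subseteq> S" for S T
    using that unfolding wirtinger_z_tower_def by blast
  have F: "wirtinger_z_tower V F"
    unfolding F_def using wirtinger_z_tower_power_branch[OF assms(5)]
    by (rule tower_mono) (simp add: V_def)
  have X: "wirtinger_z_tower V X"
    unfolding X_def using wirtinger_z_tower_power_branch[OF assms(5)]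
    by (rule tower_mono) (simp add: V_def)
  have Y: "wirtinger_z_tower V Y"
    unfolding Y_def using wirtinger_z_tower_disc_weight by (rule tower_mono) (rule V(2))
  have G: "wirtinger_z_tower V G"
    unfolding G_def using X Y by (rule wirtinger_z_tower_Leibniz)
  have G0: "G 0 w = w ^ n * of_real ((1 - (cmod w)\<^sup>2) powr (\<kappa> + real m))" if "w \<in> V" for w
    using exp_L[OF that] by (simp add: G_def X_def Y_def exp_of_nat_mult)
  \<comment> \<open>The exponent \<open>(\<kappa> + j) + (m - j)\<close> does not depend on \<open>j\<close>, so \<open>G\<close> serves every term.\<close>
  have zern: "zernike (\<kappa> + real j) (m - j) n z
      = (-1) ^ (m - j) * of_real (u powr (- (\<kappa> + real j))) * of_real P * G (m - j) z"
    if "j \<le> m" for j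
    using zernike_eq_tower[OF G V, of n "\<kappa> + real j" "m - j"] G0 that
    by (simp add: u_def P_def of_nat_diff)
  have "(wirtinger_z ^^ m) (\<lambda>w. exp (of_real (of_int (int n) + \<rho>) * L w)
               * of_real ((1 - (cmod w)\<^sup>2) powr (\<kappa> + real m))) z
      = (\<Sum>j\<le>m. of_nat (m choose j) * F j z * G (m - j) z)"
  proof (rule higher_wirtinger_z_tower[OF wirtinger_z_tower_Leibniz[OF F G] V(1) _ V(3)])
    fix w assume w: "w \<in> V"
    have "exp (of_real (of_int (int n) + \<rho>) * L w) = exp (of_real \<rho> * L w) * w ^ n"
      using exp_L[OF w] by (simp add: distrib_right exp_add exp_of_nat_mult)
    then show "exp (of_real (of_int (int n) + \<rho>) * L w) * of_real ((1 - (cmod w)\<^sup>2) powr (\<kappa> + real m))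
        = (\<Sum>j\<le>0. of_nat (0 choose j) * F j w * G (0 - j) w)"
      using w by (simp add: G0 F_def)
  qed
  then have "frac_zernike L \<kappa> \<rho> m (int n) z
      = (\<Sum>j\<le>m. (-1) ^ m * exp (of_real (-\<rho>) * L z) * of_real (u powr (-\<kappa>))
          * (of_nat (m choose j) * F j z * G (m - j) z))"
    by (simp add: frac_zernike_def u_def sum_distrib_left)
  also have "\<dots> = (\<Sum>j\<le>m. of_real (fact m * Gamma (\<rho> + 1) / P)
        * (of_real ((-1) ^ j / (fact j * fact (m - j) * Gamma (\<rho> - real j + 1)))
        * (of_real (u ^ j) / z ^ j) * zernike (\<kappa> + real j) (m - j) n z))"
  proof (rule sum.cong[OF refl])
    fix j assume "j \<in> {..m}"
    then have j: "j \<le> m" by simp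
    have binom: "complex_of_nat (m choose j) = of_real (fact m / (fact j * fact (m - j)))"
      by (simp add: binomial_fact[OF j])
    have branch: "exp (of_real (-\<rho>) * L z) * exp (of_real (\<rho> - real j) * L z) = 1 / z ^ j"
    proof -
      have "exp (of_real (-\<rho>) * L z) * exp (of_real (\<rho> - real j) * L z) = exp (- (of_nat j * L z))"
        by (simp add: exp_add[symmetric] algebra_simps)
      also have "\<dots> = 1 / z ^ j"
        using exp_L[OF V(3)] by (simp add: exp_minus exp_of_nat_mult divide_inverse)
      finally show ?thesis .
    qed
    have weight: "u powr (-\<kappa>) = u ^ j * u powr (- (\<kappa> + real j))"
      using u by (simp flip: powr_realpow powr_add)
    have sign: "(-1::complex) ^ m = (-1) ^ j * (-1) ^ (m - j)"
      using j by (simp flip: power_add)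
    have "(-1) ^ m * exp (of_real (-\<rho>) * L z) * of_real (u powr (-\<kappa>))
          * (of_nat (m choose j) * F j z * G (m - j) z)
        = (-1) ^ m * (exp (of_real (-\<rho>) * L z) * exp (of_real (\<rho> - real j) * L z))
          * of_real (u powr (-\<kappa>)) * of_nat (m choose j)
          * of_real ((-1) ^ j * pochhammer (- \<rho>) j) * G (m - j) z"
      by (simp only: F_def mult_ac)
    also have "\<dots> = (-1) ^ j * (-1) ^ (m - j) * (1 / z ^ j)
          * of_real (u ^ j * u powr (- (\<kappa> + real j))) * of_real (fact m / (fact j * fact (m - j)))
          * of_real (Gamma (\<rho> + 1) / Gamma (\<rho> - real j + 1)) * G (m - j) z"
      unfolding branch sign binom weight[symmetric]
      using Gamma_quotient_eq_pochhammer[OF assms(1), of j] by simp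
    also have "\<dots> = of_real (fact m * Gamma (\<rho> + 1) / P)
        * (of_real ((-1) ^ j / (fact j * fact (m - j) * Gamma (\<rho> - real j + 1)))
        * (of_real (u ^ j) / z ^ j) * zernike (\<kappa> + real j) (m - j) n z)"
      unfolding zern[OF j] using P by (simp add: mult_ac)
    finally show "(-1) ^ m * exp (of_real (-\<rho>) * L z) * of_real (u powr (-\<kappa>))
          * (of_nat (m choose j) * F j z * G (m - j) z)
        = of_real (fact m * Gamma (\<rho> + 1) / P)
        * (of_real ((-1) ^ j / (fact j * fact (m - j) * Gamma (\<rho> - real j + 1)))
        * (of_real (u ^ j) / z ^ j) * zernike (\<kappa> + real j) (m - j) n z)" .
  qed
  also have "\<dots> = (\<Sum>j = 0..wedge_star m \<rho>. of_real (fact m * Gamma (\<rho> + 1) / P)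
        * (of_real ((-1) ^ j / (fact j * fact (m - j) * Gamma (\<rho> - real j + 1)))
        * (of_real (u ^ j) / z ^ j) * zernike (\<kappa> + real j) (m - j) n z))"
  proof (rule sum.mono_neutral_right)
    show "{0..wedge_star m \<rho>} \<subseteq> {..m}" by (auto simp: wedge_star_def split: if_splits)
  qed (use Gamma_zero_beyond_wedge_star[OF assms(1), of m] in auto)
  finally show ?thesis by (simp only: sum_distrib_left u_def P_def)
qed

end
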